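(* Let $X$ and $Y$ be compact metric spaces, $G$ a closed relation on $X$ and $H$ a closed relation on $Y$. If $G$ and $H$ are topological conjugates, then the following statements are equivalent. 1. No Cantor set is finitely generated by $G$. 2. No Cantor set is finitely generated by $H$.
   Context: A closed relation on a compact metric space $X$ is a closed subset $G\subseteq X\times X$. Closed relations $G$ on $X$ and $H$ on $Y$ are topological conjugates if there is a homeomorphism $\varphi:X\to Y$ such that for each $(x,y)\in X\times X$: $(x,y)\in G\iff(\varphi(x),\varphi(y))\in H$. The infinite Mahavier product is $\star_{n=1}^{\infty}G^{-1}=\{(x_1,x_2,\dots)\in\prod_{i=1}^\infty X : (x_{i+1},x_i)\in G\text{ for all }i\ge1\}$ (with the subspace topology of the product topology). A subspace $A$ of $\star_{n=1}^{\infty}G^{-1}$ is finitely generated by $G$ if there is a finite set $F\subseteq G$ with $\star_{n=1}^{\infty}F^{-1}=A$. A compact metric space $Z$ is finitely generated by $G$ if some subspace $A$ of $\star_{n=1}^{\infty}G^{-1}$ is homeomorphic to $Z$ and finitely generated by $G$. A Cantor set is a space homeomorphic to the standard Cantor set. *)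

theory Defs
  imports "HOL-Analysis.Analysis"
begin

text \<open>
  Spaces are represented by abstract topologies, so that a compact metric space with carrier
  \<open>X\<close> and metric \<open>d\<close> enters as \<open>Metric_space.mtopology X d\<close>; all notions below depend on the
  topology only.
\<close>

definition closed_relation :: "'a topology \<Rightarrow> ('a \<times> 'a) set \<Rightarrow> bool" where
  "closed_relation T G \<longleftrightarrow> closedin (prod_topology T T) G"

definition topological_conjugates ::
    "'a topology \<Rightarrow> ('a \<times> 'a) set \<Rightarrow> 'b topology \<Rightarrow> ('b \<times> 'b) set \<Rightarrow> bool" where
  "topological_conjugates T G S H \<longleftrightarrow>
     (\<exists>\<phi>. homeomorphic_map T S \<phi> \<and>
          (\<forall>x\<in>topspace T. \<forall>y\<in>topspace T. (x, y) \<in> G \<longleftrightarrow> (\<phi> x, \<phi> y) \<in> H))"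

text \<open>
  \<open>mahavier T G\<close> is the infinite Mahavier product of the inverse relation of \<open>G\<close>, i.e.
  the set of sequences with \<open>(x\<^sub>i\<^sub>+\<^sub>1, x\<^sub>i) \<in> G\<close>. Sequences are indexed from 0 instead of 1.
\<close>

definition mahavier :: "'a topology \<Rightarrow> ('a \<times> 'a) set \<Rightarrow> (nat \<Rightarrow> 'a) set" where
  "mahavier T G = {x. (\<forall>i. x i \<in> topspace T) \<and> (\<forall>i. (x (Suc i), x i) \<in> G)}"

definition mahavier_space :: "'a topology \<Rightarrow> ('a \<times> 'a) set \<Rightarrow> (nat \<Rightarrow> 'a) topology" where
  "mahavier_space T G = subtopology (product_topology (\<lambda>_. T) UNIV) (mahavier T G)"

definition finitely_generated_subspace ::
    "'a topology \<Rightarrow> ('a \<times> 'a) set \<Rightarrow> (nat \<Rightarrow> 'a) set \<Rightarrow> bool" where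
  "finitely_generated_subspace T G A \<longleftrightarrow>
     A \<subseteq> mahavier T G \<and> (\<exists>F. finite F \<and> F \<subseteq> G \<and> mahavier T F = A)"

definition finitely_generated ::
    "'a topology \<Rightarrow> ('a \<times> 'a) set \<Rightarrow> 'z topology \<Rightarrow> bool" where
  "finitely_generated T G Z \<longleftrightarrow>
     (\<exists>A. finitely_generated_subspace T G A \<and>
          subtopology (mahavier_space T G) A homeomorphic_space Z)"

primrec cantor_stage :: "nat \<Rightarrow> real set" where
  "cantor_stage 0 = {0..1}"
| "cantor_stage (Suc n) =
     (\<lambda>x. x / 3) ` cantor_stage n \<union> (\<lambda>x. (2 + x) / 3) ` cantor_stage n"

definition standard_cantor_set :: "real set" where
  "standard_cantor_set = (\<Inter>n. cantor_stage n)"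

text \<open>Such a space is automatically compact and metrizable.\<close>

definition cantor_set :: "'z topology \<Rightarrow> bool" where
  "cantor_set Z \<longleftrightarrow> Z homeomorphic_space top_of_set standard_cantor_set"

end

theory Submission
  imports Defs
begin

text \<open>
  Applying a conjugacy \<open>\<phi>\<close> to every coordinate is a homeomorphism between the full products, and
  it carries the Mahavier product of a finite \<open>F \<subseteq> G\<close> onto that of the finite set of
  image pairs, which lies in \<open>H\<close> (\<open>mahavier_image\<close>). So a space finitely generated by
  \<open>G\<close> is finitely generated by \<open>H\<close> (\<open>finitely_generated_conjugate\<close>). Conjugacy being
  symmetric, both relations finitely generate exactly the same spaces, Cantor sets among them.

  Conjugacy compares the relations only on pairs of points of the spaces; closedness guarantees that
  they consist of such pairs, so that the image of \<open>F\<close> does lie in \<open>H\<close>.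
\<close>

lemma closed_relation_subset:
  assumes "closed_relation T G"
  shows "G \<subseteq> topspace T \<times> topspace T"
  using closedin_subset[of "prod_topology T T" G] assms by (simp add: closed_relation_def)

lemma topological_conjugates_sym:
  assumes "topological_conjugates T G S H"
  shows "topological_conjugates S H T G"
proof -
  obtain f g where fg: "homeomorphic_maps T S f g"
    and conj: "\<forall>x\<in>topspace T. \<forall>y\<in>topspace T. (x, y) \<in> G \<longleftrightarrow> (f x, f y) \<in> H"
    using assms unfolding topological_conjugates_def homeomorphic_map_maps by blast
  have g_in: "g y \<in> topspace T" and fg_id: "f (g y) = y" if "y \<in> topspace S" for y
    using fg that by (auto simp: homeomorphic_maps_def continuous_map_def)
  have "homeomorphic_map S T g"
    using fg homeomorphic_map_maps homeomorphic_maps_sym by blast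
  moreover have "(x, y) \<in> H \<longleftrightarrow> (g x, g y) \<in> G" if "x \<in> topspace S" "y \<in> topspace S" for x y
    using conj g_in fg_id that by simp
  ultimately show ?thesis
    unfolding topological_conjugates_def by blast
qed

lemma homeomorphic_maps_product_power:
  assumes "homeomorphic_maps T S f g"
  shows "homeomorphic_maps (product_topology (\<lambda>_. T) (UNIV :: 'i set)) (product_topology (\<lambda>_. S) UNIV)
           (\<lambda>x. f \<circ> x) (\<lambda>y. g \<circ> y)"
proof -
  have cont: "continuous_map (product_topology (\<lambda>_. U) UNIV) (product_topology (\<lambda>_. V) UNIV)
                (\<lambda>x :: 'i \<Rightarrow> _. h \<circ> x)"
    if "continuous_map U V h" for U :: "'c topology" and V :: "'d topology" and h
    unfolding continuous_map_componentwise_UNIV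
  proof
    fix i :: 'i
    have "continuous_map (product_topology (\<lambda>_. U) UNIV) V (h \<circ> (\<lambda>x. x i))"
      by (intro continuous_map_compose[OF _ that] continuous_map_product_projection) simp
    then show "continuous_map (product_topology (\<lambda>_. U) UNIV) V (\<lambda>x. (h \<circ> x) i)"
      by (simp add: o_def)
  qed
  show ?thesis
    using assms cont[of T S f] cont[of S T g]
    by (auto simp: homeomorphic_maps_def PiE_UNIV_domain fun_eq_iff Pi_iff)
qed

text \<open>
  A sequence over the image relation pulls back along the inverse of \<open>f\<close>; each of its
  consecutive pairs comes from a pair of \<open>F\<close>, and that pair is the pulled-back one because
  \<open>g\<close> inverts \<open>f\<close> on the carrier.
\<close>

lemma mahavier_image:
  assumes "homeomorphic_maps T S f g" and "F \<subseteq> topspace T \<times> topspace T"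
  shows "mahavier S (map_prod f f ` F) = (\<lambda>x. f \<circ> x) ` mahavier T F"
proof
  have f_in: "f x \<in> topspace S" and gf_id: "g (f x) = x" if "x \<in> topspace T" for x
    using assms(1) that by (auto simp: homeomorphic_maps_def continuous_map_def)
  have g_in: "g y \<in> topspace T" and fg_id: "f (g y) = y" if "y \<in> topspace S" for y
    using assms(1) that by (auto simp: homeomorphic_maps_def continuous_map_def)
  show "(\<lambda>x. f \<circ> x) ` mahavier T F \<subseteq> mahavier S (map_prod f f ` F)"
    using f_in by (force simp: mahavier_def)
  show "mahavier S (map_prod f f ` F) \<subseteq> (\<lambda>x. f \<circ> x) ` mahavier T F"
  proof
    fix y assume "y \<in> mahavier S (map_prod f f ` F)"
    then have y_in: "y i \<in> topspace S" and y_rel: "(y (Suc i), y i) \<in> map_prod f f ` F" for i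
      by (auto simp: mahavier_def)
    have "(g (y (Suc i)), g (y i)) \<in> F" for i
      using y_rel[of i] assms(2) gf_id by auto
    then have "g \<circ> y \<in> mahavier T F"
      using y_in g_in by (simp add: mahavier_def)
    moreover have "y = f \<circ> (g \<circ> y)"
      using y_in fg_id by (simp add: fun_eq_iff)
    ultimately show "y \<in> (\<lambda>x. f \<circ> x) ` mahavier T F"
      by blast
  qed
qed

lemma finitely_generated_iff:
  "finitely_generated T G Z \<longleftrightarrow>
     (\<exists>F. finite F \<and> F \<subseteq> G \<and>
          subtopology (product_topology (\<lambda>_. T) UNIV) (mahavier T F) homeomorphic_space Z)"
proof -
  have "mahavier T F \<subseteq> mahavier T G" if "F \<subseteq> G" for F
    using that by (auto simp: mahavier_def)
  then show ?thesis
    unfolding finitely_generated_def finitely_generated_subspace_def mahavier_space_def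
    by (metis inf.absorb_iff2 subtopology_subtopology)
qed

lemma finitely_generated_conjugate:
  assumes "topological_conjugates T G S H" and G_sub: "G \<subseteq> topspace T \<times> topspace T"
    and "finitely_generated T G Z"
  shows "finitely_generated S H Z"
proof -
  obtain f g where fg: "homeomorphic_maps T S f g"
    and conj: "\<forall>x\<in>topspace T. \<forall>y\<in>topspace T. (x, y) \<in> G \<longleftrightarrow> (f x, f y) \<in> H"
    using assms(1) unfolding topological_conjugates_def homeomorphic_map_maps by blast
  obtain F where F: "finite F" "F \<subseteq> G"
    and Z: "subtopology (product_topology (\<lambda>_. T) UNIV) (mahavier T F) homeomorphic_space Z"
    using assms(3) unfolding finitely_generated_iff by blast
  let ?F = "map_prod f f ` F"
  have image: "mahavier S ?F = (\<lambda>x. f \<circ> x) ` mahavier T F"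
    using mahavier_image[OF fg] F(2) G_sub by blast
  have in_T: "mahavier T F \<subseteq> topspace (product_topology (\<lambda>_. T) UNIV)"
    by (auto simp: mahavier_def)
  have power: "homeomorphic_map (product_topology (\<lambda>_. T) UNIV) (product_topology (\<lambda>_. S) UNIV)
                 (\<lambda>x :: nat \<Rightarrow> 'a. f \<circ> x)"
    using homeomorphic_maps_product_power[OF fg] homeomorphic_map_maps by blast
  have "homeomorphic_map (subtopology (product_topology (\<lambda>_. T) UNIV) (mahavier T F))
          (subtopology (product_topology (\<lambda>_. S) UNIV) (mahavier S ?F)) (\<lambda>x. f \<circ> x)"
    by (rule homeomorphic_map_subtopologies[OF power])
       (use in_T image homeomorphic_imp_surjective_map[OF power] in blast)
  then have "subtopology (product_topology (\<lambda>_. S) UNIV) (mahavier S ?F) homeomorphic_space Z"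
    using Z homeomorphic_map_imp_homeomorphic_space homeomorphic_space_sym homeomorphic_space_trans
    by blast
  moreover have "finite ?F" "?F \<subseteq> H"
    using F G_sub conj by auto
  ultimately show ?thesis
    unfolding finitely_generated_iff by blast
qed

theorem theorem5p6:
  fixes X :: "'a set" and dX :: "'a \<Rightarrow> 'a \<Rightarrow> real" and G :: "('a \<times> 'a) set"
    and Y :: "'b set" and dY :: "'b \<Rightarrow> 'b \<Rightarrow> real" and H :: "('b \<times> 'b) set"
  assumes "Metric_space X dX" and "compact_space (Metric_space.mtopology X dX)"
    and "Metric_space Y dY" and "compact_space (Metric_space.mtopology Y dY)"
    and "closed_relation (Metric_space.mtopology X dX) G"
    and "closed_relation (Metric_space.mtopology Y dY) H"
    and "topological_conjugates (Metric_space.mtopology X dX) G (Metric_space.mtopology Y dY) H"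
  shows "(\<nexists>Z :: 'z topology. cantor_set Z \<and> finitely_generated (Metric_space.mtopology X dX) G Z)
     \<longleftrightarrow> (\<nexists>Z :: 'z topology. cantor_set Z \<and> finitely_generated (Metric_space.mtopology Y dY) H Z)"
  using finitely_generated_conjugate[OF assms(7) closed_relation_subset[OF assms(5)]]
    finitely_generated_conjugate[OF topological_conjugates_sym[OF assms(7)]
      closed_relation_subset[OF assms(6)]]
  by blast

end
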